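(* Let $N$ be a friend of $20$ and let $P$ be the largest prime divisor of $N$. Then $P<N^{\frac{1}{4}}$.
   Context: For a positive integer $n$, $\sigma(n)$ denotes the sum of the positive divisors of $n$, and the abundancy index of $n$ is $I(n)=\sigma(n)/n$. A positive integer $N>20$ is called a friend of $20$ if $I(N)=I(20)=21/10$. *)

theory Defs
  imports Complex_Main "HOL-Computational_Algebra.Primes"
begin

definition divisor_sigma :: "nat \<Rightarrow> nat" where
  "divisor_sigma n = (\<Sum>d | d dvd n. d)"

definition abundancy :: "nat \<Rightarrow> real" where
  "abundancy n = real (divisor_sigma n) / real n"

definition friend_of_20 :: "nat \<Rightarrow> bool" where
  "friend_of_20 N \<longleftrightarrow> N > 20 \<and> abundancy N = abundancy 20"

lemma divisors_20: "{d. d dvd (20::nat)} = {1, 2, 4, 5, 10, 20}"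
proof -
  have "{d. d dvd (20::nat)} = Set.filter (\<lambda>d. d dvd 20) {..20}"
    by (auto dest: dvd_imp_le)
  also have "\<dots> = {1, 2, 4, 5, 10, 20}"
    by code_simp
  finally show ?thesis .
qed

lemma abundancy_20: "abundancy 20 = 21 / 10"
  by (simp add: abundancy_def divisor_sigma_def divisors_20)

lemma friend_of_20_iff: "friend_of_20 N \<longleftrightarrow> N > 20 \<and> abundancy N = 21 / 10"
  by (simp add: friend_of_20_def abundancy_20)

end

theory Submission
  imports Defs
begin

text \<open>
  Clearing denominators, \<open>10 \<sigma>(N) = 21 N\<close>, so \<open>10\<close> divides \<open>N\<close>. A proper multiple of \<open>20\<close> has
  larger abundancy than \<open>20\<close>, so \<open>N = 2 m\<close> with \<open>m\<close> odd and \<open>5 \<sigma>(m) = 7 m\<close>. Write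
  \<open>m = P ^ e * t\<close> with \<open>P\<close> not dividing \<open>t\<close>. If \<open>e \<ge> 4\<close>, the bound is immediate. Moreover \<open>e\<close> is
  even, since \<open>\<sigma>(P ^ e)\<close> divides the odd number \<open>7 m\<close>. If \<open>e = 2\<close>, then
  \<open>5 (P\<^sup>2 + P + 1) \<sigma>(t) = 7 P\<^sup>2 t\<close>, and \<open>P \<noteq> 5\<close> since otherwise the prime \<open>31 > P\<close> divides \<open>N\<close>; by
  coprimality \<open>5 (P\<^sup>2 + P + 1)\<close> divides \<open>7 t\<close>, whence \<open>N = 2 P\<^sup>2 t > 10/7 P ^ 4\<close>.
\<close>

text \<open>Each divisor of \<open>a * b\<close> factors uniquely as \<open>x * y\<close> with
  \<open>x dvd a\<close> and \<open>y dvd b\<close>: coprimality lets \<open>x\<close> and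
  \<open>y\<close> be recovered as its gcds with \<open>a\<close> and \<open>b\<close>. The sum over
  divisors then becomes a product of two sums.\<close>

lemma divisor_sigma_mult:
  assumes "coprime a b"
  shows "divisor_sigma (a * b) = divisor_sigma a * divisor_sigma b"
proof -
  have gcd_left: "gcd (x * y) a = x" if "x dvd a" "y dvd b" for x y
  proof -
    have "coprime y a"
      using that(2) assms by (meson coprime_commute coprime_divisors dvd_refl)
    then have "gcd (x * y) a = gcd x a"
      by (simp add: gcd_mult_left_right_cancel coprime_commute)
    with that(1) show ?thesis
      by (simp add: gcd_nat.absorb1)
  qed
  have gcd_right: "gcd (x * y) b = y" if "x dvd a" "y dvd b" for x y
  proof -
    have "coprime x b"
      using that(1) assms by (meson coprime_divisors dvd_refl)
    then have "gcd (x * y) b = gcd y b"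
      by (simp add: gcd_mult_left_left_cancel coprime_commute)
    with that(2) show ?thesis
      by (simp add: gcd_nat.absorb1)
  qed
  have "bij_betw (\<lambda>(x, y). x * y) ({d. d dvd a} \<times> {d. d dvd b}) {d. d dvd a * b}"
    unfolding bij_betw_def
  proof
    show "inj_on (\<lambda>(x, y). x * y) ({d. d dvd a} \<times> {d. d dvd b})"
      by (rule inj_on_inverseI[where g = "\<lambda>z. (gcd z a, gcd z b)"]) (auto simp: gcd_left gcd_right)
    show "(\<lambda>(x, y). x * y) ` ({d. d dvd a} \<times> {d. d dvd b}) = {d. d dvd a * b}"
    proof (intro subset_antisym subsetI)
      fix d assume "d \<in> {d. d dvd a * b}"
      then obtain x y where "d = x * y" "x dvd a" "y dvd b"
        using division_decomp[of d a b] by blast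
      then show "d \<in> (\<lambda>(x, y). x * y) ` ({d. d dvd a} \<times> {d. d dvd b})"
        by force
    qed (auto intro: mult_dvd_mono)
  qed
  then have "divisor_sigma (a * b) = (\<Sum>(x, y)\<in>{d. d dvd a} \<times> {d. d dvd b}. x * y)"
    unfolding divisor_sigma_def
    by (subst sum.reindex_bij_betw[symmetric]) (auto simp: case_prod_unfold)
  then show ?thesis
    by (simp add: divisor_sigma_def sum_product sum.cartesian_product)
qed

lemma divisor_sigma_prime_power:
  assumes "prime p"
  shows "divisor_sigma (p ^ e) = (\<Sum>i\<le>e. p ^ i)"
proof -
  have "{d. d dvd p ^ e} = (\<lambda>i. p ^ i) ` {..e}"
    using assms by (auto simp: divides_primepow_nat)
  moreover have "inj_on (\<lambda>i. p ^ i) {..e}"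
    using assms prime_gt_1_nat by (auto intro!: inj_onI)
  ultimately show ?thesis
    by (simp add: divisor_sigma_def sum.reindex)
qed

text \<open>Scaling the divisors of \<open>n\<close> by \<open>k\<close> gives divisors of
  \<open>n * k\<close> that are all multiples of \<open>k\<close>; the divisor 1 is not among them
  and makes the inequality strict.\<close>

lemma divisor_sigma_multiple_gt:
  assumes "1 < k" "0 < n"
  shows "k * divisor_sigma n < divisor_sigma (n * k)"
proof -
  let ?A = "(\<lambda>d. k * d) ` {d. d dvd n}"
  have fin: "finite ?A"
    using assms by simp
  have "1 \<notin> ?A"
  proof
    assume "1 \<in> ?A"
    then have "k dvd 1"
      by (metis dvd_triv_left imageE)
    with assms(1) show False
      by simp
  qed
  have "k * divisor_sigma n = \<Sum>?A"
    unfolding divisor_sigma_def sum_distrib_left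
    using assms by (simp add: sum.reindex inj_on_def)
  also have "\<dots> < 1 + \<Sum>?A"
    by simp
  also have "\<dots> = \<Sum>(insert 1 ?A)"
    by (rule sum.insert[OF fin \<open>1 \<notin> ?A\<close>, symmetric])
  also have "\<dots> \<le> divisor_sigma (n * k)"
    unfolding divisor_sigma_def
  proof (rule sum_mono2)
    show "insert 1 ?A \<subseteq> {d. d dvd n * k}"
      by (auto simp: mult.commute[of n] intro: mult_dvd_mono)
  qed (use assms in auto)
  finally show ?thesis .
qed

lemma friend_of_20_sigma:
  assumes "friend_of_20 N"
  shows "10 * divisor_sigma N = 21 * N"
proof -
  have "N > 20" "real (divisor_sigma N) / real N = 21 / 10"
    using assms by (auto simp: friend_of_20_iff abundancy_def)
  then have "real (10 * divisor_sigma N) = real (21 * N)"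
    by (simp add: field_simps)
  then show ?thesis
    by (simp only: of_nat_eq_iff)
qed

lemma friend_of_20_dvd:
  assumes "friend_of_20 N"
  shows "10 dvd N" "\<not> 4 dvd N"
proof -
  note sigma = friend_of_20_sigma[OF assms]
  show "10 dvd N"
    using sigma by presburger
  show "\<not> 4 dvd N"
  proof
    assume "4 dvd N"
    with \<open>10 dvd N\<close> have "20 dvd N"
      by presburger
    then obtain k where k: "N = 20 * k" ..
    moreover have "N > 20"
      using assms by (simp add: friend_of_20_def)
    \<comment> \<open>The left side is \<open>42 * k\<close>, which is exactly the value that
      \<open>sigma\<close> forces on \<open>divisor_sigma N\<close>.\<close>
    ultimately have "k * divisor_sigma 20 < divisor_sigma N"
      by (auto intro: divisor_sigma_multiple_gt)
    moreover have "divisor_sigma 20 = 42"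
      by (simp add: divisor_sigma_def divisors_20)
    ultimately show False
      using sigma k by simp
  qed
qed

lemma friend_of_20_odd_part:
  assumes "friend_of_20 N"
  obtains m where "N = 2 * m" "odd m" "5 dvd m" "5 * divisor_sigma m = 7 * m"
proof -
  obtain j where j: "N = 10 * j"
    using friend_of_20_dvd(1)[OF assms] ..
  define m where "m = 5 * j"
  have N: "N = 2 * m"
    by (simp add: j m_def)
  have "odd m"
    using friend_of_20_dvd(2)[OF assms] by (auto simp: N)
  moreover have "divisor_sigma 2 = 3"
    using divisor_sigma_prime_power[of 2 1] by simp
  ultimately have "divisor_sigma N = 3 * divisor_sigma m"
    by (simp add: N divisor_sigma_mult)
  then have "5 * divisor_sigma m = 7 * m"
    using friend_of_20_sigma[OF assms] by (simp add: N)
  with N \<open>odd m\<close> show ?thesis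
    by (intro that[of m]) (auto simp: m_def)
qed

text \<open>Maximality of \<open>P\<close> enters twice: through the prime 5, to get
  \<open>5 \<le> P\<close>, and through the prime 31, to exclude \<open>P = 5\<close> when
  \<open>e = 2\<close>.\<close>

lemma friend_of_20_largest_prime_power4_less:
  assumes friend: "friend_of_20 N"
    and P: "prime P" "P dvd N"
    and largest: "\<And>q. prime q \<Longrightarrow> q dvd N \<Longrightarrow> q \<le> P"
  shows "P ^ 4 < N"
proof -
  obtain m where m: "N = 2 * m" "odd m" "5 dvd m" "5 * divisor_sigma m = 7 * m"
    using friend_of_20_odd_part[OF friend] .
  have "m > 0"
    using m(2) by (auto intro: Nat.gr0I)
  have "prime (5::nat)"
    by simp
  then have "5 \<le> P"
    using largest m(1,3) by simp
  then have "odd P"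
    using P(1) by (simp add: prime_odd_nat)
  with P m(1) \<open>5 \<le> P\<close> have "P dvd m"
    by (auto simp: prime_dvd_mult_iff dest: dvd_imp_le)
  define e where "e = multiplicity P m"
  obtain t where t: "m = P ^ e * t" "\<not> P dvd t"
    using multiplicity_decompose'[of m P] \<open>m > 0\<close> P(1) unfolding e_def
    by (metis not_prime_unit not_gr_zero)
  have "e \<noteq> 0"
    using t \<open>P dvd m\<close> by (metis mult_1 power_0)
  have "coprime (P ^ e) t"
    using t(2) P(1) by (simp add: prime_imp_coprime)
  then have eq: "5 * (\<Sum>i\<le>e. P ^ i) * divisor_sigma t = 7 * (P ^ e * t)"
    using m(4) P(1) t(1) by (simp add: divisor_sigma_mult divisor_sigma_prime_power)
  have "t > 0"
    using \<open>m > 0\<close> t(1) by simp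
  have "odd (\<Sum>i\<le>e. P ^ i)"
  proof
    assume "even (\<Sum>i\<le>e. P ^ i)"
    then have "even (7 * m)"
      using eq t(1) by (metis dvd_mult dvd_mult2)
    with m(2) show False
      by simp
  qed
  \<comment> \<open>All \<open>e + 1\<close> summands are odd, so an odd sum forces
    \<open>e + 1\<close> to be odd.\<close>
  then have "even e"
    using \<open>odd P\<close> by (simp add: even_sum_iff)
  with \<open>e \<noteq> 0\<close> have "e = 2 \<or> 4 \<le> e"
    by presburger
  then consider "e = 2" | "4 \<le> e"
    by blast
  then show ?thesis
  proof cases
    case 1
    then have eq: "5 * (1 + P + P\<^sup>2) * divisor_sigma t = 7 * P\<^sup>2 * t"
      using eq by (simp add: numeral_eq_Suc algebra_simps)
    have "P \<noteq> 5"
    proof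
      assume "P = 5"
      \<comment> \<open>Here 31 is \<open>1 + 5 + 5^2\<close>, and a common factor 5 has been
        cancelled.\<close>
      then have "31 * divisor_sigma t = 35 * t"
        using eq by simp
      then have "31 dvd 35 * t"
        by (metis dvd_triv_left)
      moreover have "coprime 31 (35::nat)"
        by (simp add: coprime_iff_gcd_eq_1 gcd_non_0_nat)
      ultimately have "31 dvd t"
        by (simp only: coprime_dvd_mult_right_iff)
      then have "31 dvd N"
        by (simp add: m(1) t(1))
      moreover have "prime (31::nat)"
        by simp
      ultimately show False
        using largest \<open>P = 5\<close> by fastforce
    qed
    then have "coprime 5 (P\<^sup>2)"
      using P(1) by (simp add: primes_coprime)
    moreover have "coprime (1 + P + P\<^sup>2) (P\<^sup>2)"
    proof -
      \<comment> \<open>The number is congruent to 1 modulo \<open>P\<close>.\<close>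
      have "coprime (1 + P * (1 + P)) P"
        by (metis add.commute coprime_1_left coprime_iff_gcd_eq_1 gcd_add_mult mult.commute gcd.commute)
      then show ?thesis
        by (simp add: power2_eq_square algebra_simps)
    qed
    ultimately have "coprime (5 * (1 + P + P\<^sup>2)) (P\<^sup>2)"
      by (simp only: coprime_mult_left_iff)
    moreover have "5 * (1 + P + P\<^sup>2) dvd P\<^sup>2 * (7 * t)"
      using eq by (metis dvd_triv_left mult.assoc mult.commute)
    ultimately have "5 * (1 + P + P\<^sup>2) dvd 7 * t"
      by (simp only: coprime_dvd_mult_right_iff)
    then have "5 * (1 + P + P\<^sup>2) \<le> 7 * t"
      using \<open>t > 0\<close> by (intro dvd_imp_le) auto
    \<comment> \<open>The bound gives \<open>5 * P^2 < 7 * t\<close>; weakening 7/5 to 2 matches the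
      factor 2 in \<open>N = 2 * P^2 * t\<close>.\<close>
    then have "P\<^sup>2 < 2 * t"
      by simp
    then have "P\<^sup>2 * P\<^sup>2 < P\<^sup>2 * (2 * t)"
      using \<open>5 \<le> P\<close> by (intro mult_strict_left_mono) auto
    then show ?thesis
      using 1 by (simp add: m(1) t(1) mult_ac flip: power_add)
  next
    case 2
    then have "P ^ 4 dvd m"
      by (simp add: t(1) le_imp_power_dvd)
    then have "P ^ 4 \<le> m"
      using \<open>m > 0\<close> by (rule dvd_imp_le)
    \<comment> \<open>Strictness comes from \<open>N = 2 * m > m\<close>.\<close>
    with m(1) \<open>m > 0\<close> show ?thesis
      by simp
  qed
qed

theorem theorem8:
  fixes N P :: nat
  assumes "friend_of_20 N"
    and "P = Max {p. prime p \<and> p dvd N}"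
  shows "real P < real N powr (1 / 4)"
proof -
  let ?S = "{p. prime p \<and> p dvd N}"
  have N: "N > 20"
    using assms(1) by (simp add: friend_of_20_def)
  \<comment> \<open>\<open>Max\<close> is meaningful only on a finite nonempty set;
    \<open>N > 20\<close> yields finiteness through \<open>N > 0\<close> and a prime factor through
    \<open>N \<noteq> 1\<close>.\<close>
  have "?S \<subseteq> {..N}"
    using N by (auto intro: dvd_imp_le)
  then have fin: "finite ?S"
    by (rule finite_subset) simp
  moreover have "?S \<noteq> {}"
    using N prime_factor_nat[of N] by auto
  ultimately have "P \<in> ?S"
    unfolding assms(2) by (rule Max_in)
  moreover have "q \<le> P" if "prime q" "q dvd N" for q
    unfolding assms(2) using fin that by (intro Max_ge) auto
  ultimately have "P ^ 4 < N"
    using assms(1) by (intro friend_of_20_largest_prime_power4_less) auto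
  then have "real P ^ 4 < real N"
    by (metis of_nat_less_iff of_nat_power)
  then have "(real P ^ 4) powr (1 / 4) < real N powr (1 / 4)"
    by (intro powr_less_mono2) auto
  moreover have "(real P ^ 4) powr (1 / 4) = real P"
    using \<open>P \<in> ?S\<close> by (simp add: prime_gt_0_nat powr_powr flip: powr_numeral)
  ultimately show ?thesis
    by simp
qed

end
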